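(* Let $c_L\in\mathbb{C}$, $c_{L,I}\in\mathbb{C}\setminus\{0\}$, and put $c_W=-24c_{L,I}^2$. There is a non-trivial homomorphism of vertex algebras $$\Psi:L^{W(2,2)}(c_L,c_W)\to L^{\mathcal H}(c_L,c_{L,I}),\qquad \omega\mapsto L(-2)\mathbf 1,\qquad w\mapsto\left(I(-1)^2+2c_{L,I}I(-2)\right)\mathbf 1 .$$
   Context: The twisted Heisenberg-Virasoro algebra $\mathcal H$ is the complex Lie algebra with basis $\{L(n),I(n):n\in\mathbb{Z}\}\cup\{C_L,C_{LI},C_I\}$ and brackets $[L(n),L(m)]=(n-m)L(n+m)+\delta_{n,-m}\frac{n^3-n}{12}C_L$, $[L(n),I(m)]=-mI(n+m)-\delta_{n,-m}(n^2+n)C_{LI}$, $[I(n),I(m)]=n\delta_{n,-m}C_I$, with $C_L,C_{LI},C_I$ central. $L^{\mathcal H}(c_L,c_{L,I})$ denotes the irreducible highest weight $\mathcal H$-module with highest weight vector $\mathbf 1$ ($L(n)\mathbf 1=I(n)\mathbf 1=0$ for $n\ge0$) on which $C_L,C_I,C_{LI}$ act as $c_L,0,c_{L,I}$, with its structure of simple vertex algebra generated by $I(z)=\sum I(n)z^{-n-1}$ and $L(z)=\sum L(n)z^{-n-2}$. The Lie algebra $W(2,2)$ has basis $\{W(n),L(n),C,C_W:n\in\mathbb{Z}\}$ over $\mathbb{C}$, with $[L(n),L(m)]=(n-m)L(n+m)+\delta_{n,-m}\frac{n^3-n}{12}C$, $[L(n),W(m)]=(n-m)W(n+m)+\delta_{n,-m}\frac{n^3-n}{12}C_W$,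 $[W(n),W(m)]=0$, and $C,C_W$ central. $L^{W(2,2)}(c_L,c_W)$ is the universal vertex algebra associated to $W(2,2)$ at central charges $C=c_L$, $C_W=c_W$: it is generated by the fields $L(z)=Y(\omega,z)=\sum L(n)z^{-n-2}$ and $W(z)=Y(w,z)=\sum W(n)z^{-n-2}$, where $\omega=L(-2)\mathbf 1$, $w=W(-2)\mathbf 1$. *)

theory Defs
  imports Complex_Main "HOL-Library.Poly_Mapping" "HOL-Library.Groups_Big_Fun"
begin

section \<open>Free complex vector spaces\<close>

definition pm_scale :: "complex \<Rightarrow> ('k \<Rightarrow>\<^sub>0 complex) \<Rightarrow> ('k \<Rightarrow>\<^sub>0 complex)"
  where "pm_scale c = Poly_Mapping.map ((*) c)"

definition lin_ext ::
    "(complex \<Rightarrow> 'v \<Rightarrow> 'v) \<Rightarrow> ('k \<Rightarrow> 'v) \<Rightarrow> ('k \<Rightarrow>\<^sub>0 complex) \<Rightarrow> 'v::comm_monoid_add"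
  where "lin_ext s f p = (\<Sum>k\<in>Poly_Mapping.keys p. s (Poly_Mapping.lookup p k) (f k))"

lemma lookup_pm_scale [simp]:
  "Poly_Mapping.lookup (pm_scale c p) k = c * Poly_Mapping.lookup p k"
  unfolding pm_scale_def by (transfer) (simp add: when_def)

interpretation pm: vector_space pm_scale
  by standard (auto intro!: poly_mapping_eqI simp: lookup_add algebra_simps)

context
  fixes s :: "complex \<Rightarrow> 'v::ab_group_add \<Rightarrow> 'v"
  assumes vs: "vector_space s"
begin

interpretation vector_space s by (rule vs)

lemma lin_ext_superset:
  assumes "finite A" "Poly_Mapping.keys p \<subseteq> A"
  shows "lin_ext s f p = (\<Sum>k\<in>A. s (Poly_Mapping.lookup p k) (f k))"
  unfolding lin_ext_def using assms
  by (intro sum.mono_neutral_left) (auto simp: in_keys_iff)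

lemma lin_ext_single:
  "lin_ext s f (Poly_Mapping.single k c) = s c (f k)"
  by (subst lin_ext_superset[where A = "{k}"]) auto

lemma lin_ext_zero: "lin_ext s f 0 = 0"
  by (simp add: lin_ext_def)

lemma lin_ext_add:
  "lin_ext s f (p + q) = lin_ext s f p + lin_ext s f q"
proof -
  let ?A = "Poly_Mapping.keys p \<union> Poly_Mapping.keys q"
  have "Poly_Mapping.keys (p + q) \<subseteq> ?A" by (rule Poly_Mapping.keys_add)
  then show ?thesis
    by (simp add: lin_ext_superset[where A = ?A] lookup_add scale_left_distrib sum.distrib)
qed

lemma lin_ext_uminus:
  "lin_ext s f (- p) = - lin_ext s f p"
  using lin_ext_add[of f p "- p"]
  by (simp add: lin_ext_zero eq_neg_iff_add_eq_0 add.commute)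

lemma lin_ext_diff:
  "lin_ext s f (p - q) = lin_ext s f p - lin_ext s f q"
  using lin_ext_add[of f p "- q"] by (simp add: lin_ext_uminus)

end

lemmas pm_lin_ext = lin_ext_single lin_ext_zero lin_ext_add lin_ext_uminus lin_ext_diff
lemmas pm_lin_ext' [simp] = pm_lin_ext[OF pm.vector_space_axioms]


section \<open>Lie algebras given by a basis, and their modules\<close>

text \<open>
  The type \<open>'b\<close> is a basis of the Lie algebra, whose elements are the finitely supported
  \<open>'b \<Rightarrow>\<^sub>0 complex\<close>; \<open>br\<close> gives the brackets of basis vectors.
\<close>

locale lie_algebra_basis =
  fixes br :: "'b \<Rightarrow> 'b \<Rightarrow> 'b \<Rightarrow>\<^sub>0 complex"
  assumes br_self: "br a a = 0"
    and br_skew: "br a b = - br b a"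
    and br_jacobi: "lin_ext pm_scale (br a) (br b c) + lin_ext pm_scale (br b) (br c a)
                    + lin_ext pm_scale (br c) (br a b) = 0"

text \<open>\<open>act x\<close> is the action of the basis vector \<open>x\<close>; general elements act by linearity.\<close>

locale lie_module = vector_space scale + lie_algebra_basis br
  for scale :: "complex \<Rightarrow> 'v::ab_group_add \<Rightarrow> 'v"
    and br :: "'b \<Rightarrow> 'b \<Rightarrow> 'b \<Rightarrow>\<^sub>0 complex" +
  fixes act :: "'b \<Rightarrow> 'v \<Rightarrow> 'v"
  assumes act_linear: "Vector_Spaces.linear scale scale (act x)"
    and act_bracket: "lin_ext scale (\<lambda>z. act z v) (br x y) = act x (act y v) - act y (act x v)"
begin

definition irreducible_module :: bool
  where "irreducible_module \<longleftrightarrow> (\<exists>v::'v. v \<noteq> 0) \<and>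
    (\<forall>S. subspace S \<and> (\<forall>x. \<forall>v\<in>S. act x v \<in> S) \<longrightarrow> S = {0} \<or> S = UNIV)"

end

text \<open>
  Words in the basis form a basis of the tensor algebra \<open>T(g)\<close>. The span of the first set
  below is the two-sided ideal with \<open>T(g)/(..) = U(g)\<close>; the second set adds the left ideal
  generated by \<open>x - \<chi> x\<close> for \<open>x \<in> P\<close>. Hence, if \<open>P\<close> spans a subalgebra \<open>p\<close> and \<open>\<chi>\<close> is a
  character of \<open>p\<close>, the quotient of \<open>T(g)\<close> by the relations is the module \<open>U(g) \<otimes>\<^bsub>U(p)\<^esub> \<chi>\<close>.
\<close>

definition induced_relations ::
    "('b \<Rightarrow> 'b \<Rightarrow> 'b \<Rightarrow>\<^sub>0 complex) \<Rightarrow> 'b set \<Rightarrow> ('b \<Rightarrow> complex) \<Rightarrow> ('b list \<Rightarrow>\<^sub>0 complex) set"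
  where "induced_relations br P \<chi> = pm.span (
    {Poly_Mapping.single (u @ [x, y] @ v) 1 - Poly_Mapping.single (u @ [y, x] @ v) 1
       - lin_ext pm_scale (\<lambda>z. Poly_Mapping.single (u @ [z] @ v) 1) (br x y) | u v x y. True} \<union>
    {Poly_Mapping.single (u @ [x]) 1 - Poly_Mapping.single u (\<chi> x) | u x. x \<in> P})"

text \<open>
  \<open>V\<close> is the induced module with cyclic vector \<open>e\<close> iff \<open>T(g) \<rightarrow> V, t \<mapsto> t e\<close> is onto
  with kernel the relations above.
\<close>

locale induced_module = lie_module scale br act
  for scale :: "complex \<Rightarrow> 'v::ab_group_add \<Rightarrow> 'v"
    and br :: "'b \<Rightarrow> 'b \<Rightarrow> 'b \<Rightarrow>\<^sub>0 complex"
    and act :: "'b \<Rightarrow> 'v \<Rightarrow> 'v" +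
  fixes P :: "'b set" and \<chi> :: "'b \<Rightarrow> complex" and e :: 'v
  assumes cyclic: "\<exists>t. v = lin_ext scale (\<lambda>w. foldr act w e) t"
    and kernel: "lin_ext scale (\<lambda>w. foldr act w e) t = 0 \<longleftrightarrow> t \<in> induced_relations br P \<chi>"


section \<open>The twisted Heisenberg-Virasoro algebra and \<open>W(2,2)\<close>\<close>

datatype heis_vir = HL int | HI int | HC\<^sub>L | HC\<^sub>L\<^sub>I | HC\<^sub>I

fun heis_vir_br :: "heis_vir \<Rightarrow> heis_vir \<Rightarrow> heis_vir \<Rightarrow>\<^sub>0 complex" where
  "heis_vir_br (HL n) (HL m) = Poly_Mapping.single (HL (n + m)) (of_int (n - m))
     + Poly_Mapping.single HC\<^sub>L (if n = - m then of_int (n ^ 3 - n) / 12 else 0)"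
| "heis_vir_br (HL n) (HI m) = - Poly_Mapping.single (HI (n + m)) (of_int m)
     - Poly_Mapping.single HC\<^sub>L\<^sub>I (if n = - m then of_int (n ^ 2 + n) else 0)"
| "heis_vir_br (HI m) (HL n) = Poly_Mapping.single (HI (n + m)) (of_int m)
     + Poly_Mapping.single HC\<^sub>L\<^sub>I (if n = - m then of_int (n ^ 2 + n) else 0)"
| "heis_vir_br (HI n) (HI m) = Poly_Mapping.single HC\<^sub>I (if n = - m then of_int n else 0)"
| "heis_vir_br _ _ = 0"

datatype w22 = WL int | WW int | WC | WC\<^sub>W

fun w22_br :: "w22 \<Rightarrow> w22 \<Rightarrow> w22 \<Rightarrow>\<^sub>0 complex" where
  "w22_br (WL n) (WL m) = Poly_Mapping.single (WL (n + m)) (of_int (n - m))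
     + Poly_Mapping.single WC (if n = - m then of_int (n ^ 3 - n) / 12 else 0)"
| "w22_br (WL n) (WW m) = Poly_Mapping.single (WW (n + m)) (of_int (n - m))
     + Poly_Mapping.single WC\<^sub>W (if n = - m then of_int (n ^ 3 - n) / 12 else 0)"
| "w22_br (WW m) (WL n) = - Poly_Mapping.single (WW (n + m)) (of_int (n - m))
     - Poly_Mapping.single WC\<^sub>W (if n = - m then of_int (n ^ 3 - n) / 12 else 0)"
| "w22_br _ _ = 0"

interpretation heis_vir: lie_algebra_basis heis_vir_br
proof
  fix a b c
  show "heis_vir_br a a = 0"
    by (cases a) (auto intro!: poly_mapping_eqI)
  show "heis_vir_br a b = - heis_vir_br b a"
    by (cases a; cases b)
       (auto intro!: poly_mapping_eqI simp: lookup_add lookup_minus lookup_single when_def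
          add.commute field_simps)
  show "lin_ext pm_scale (heis_vir_br a) (heis_vir_br b c)
      + lin_ext pm_scale (heis_vir_br b) (heis_vir_br c a)
      + lin_ext pm_scale (heis_vir_br c) (heis_vir_br a b) = 0"
    apply (rule poly_mapping_eqI; rename_tac k; case_tac k; cases a; cases b; cases c;
        simp add: lookup_add lookup_minus lookup_single when_def)
    apply (auto simp: power2_eq_square power3_eq_cube algebra_simps)
    apply (drule equation_minus_iff[THEN iffD1], hypsubst_thin, simp add: field_simps,
        (simp add: field_simps)?)+
    done
qed

interpretation w22: lie_algebra_basis w22_br
proof
  fix a b c
  show "w22_br a a = 0"
    by (cases a) (auto intro!: poly_mapping_eqI)
  show "w22_br a b = - w22_br b a"
    by (cases a; cases b)
       (auto intro!: poly_mapping_eqI simp: lookup_add lookup_minus lookup_single when_def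
          add.commute field_simps)
  show "lin_ext pm_scale (w22_br a) (w22_br b c)
      + lin_ext pm_scale (w22_br b) (w22_br c a)
      + lin_ext pm_scale (w22_br c) (w22_br a b) = 0"
    apply (rule poly_mapping_eqI; rename_tac k; case_tac k; cases a; cases b; cases c;
        simp add: lookup_add lookup_minus lookup_single when_def)
    apply (auto simp: power2_eq_square power3_eq_cube algebra_simps)
    apply (drule equation_minus_iff[THEN iffD1], hypsubst_thin, simp add: field_simps,
        (simp add: field_simps)?)+
    done
qed


section \<open>Vertex algebras\<close>

text \<open>
  \<open>Y a n b\<close> is the \<open>n\<close>-th product \<open>a\<^sub>n b\<close>, i.e. \<open>Y(a,z) = \<Sum>n. a\<^sub>n z^(-n-1)\<close>. The last
  assumption is the Jacobi (Borcherds) identity in components; by \<open>truncation\<close> its two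
  sums have finite support.
\<close>

locale vertex_algebra = vector_space scale
  for scale :: "complex \<Rightarrow> 'v::ab_group_add \<Rightarrow> 'v"  (infixr \<open>*s\<close> 75) +
  fixes Y :: "'v \<Rightarrow> int \<Rightarrow> 'v \<Rightarrow> 'v" and vac :: 'v
  assumes Y_linear_left: "Vector_Spaces.linear scale scale (\<lambda>a. Y a n b)"
    and Y_linear_right: "Vector_Spaces.linear scale scale (Y a n)"
    and truncation: "\<exists>N. \<forall>n\<ge>N. Y a n b = 0"
    and vacuum: "Y vac n a = (if n = -1 then a else 0)"
    and creation: "n \<ge> 0 \<Longrightarrow> Y a n vac = 0" "Y a (-1) vac = a"
    and borcherds:
      "Sum_any (\<lambda>j::nat. (of_int m gchoose j) *s Y (Y a (n + int j) b) (m + k - int j) c)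
     = Sum_any (\<lambda>j::nat. ((-1) ^ j * (of_int n gchoose j)) *s
         (Y a (m + n - int j) (Y b (k + int j) c)
          - ((-1) powi n) *s Y b (n + k - int j) (Y a (m + int j) c)))"

locale vertex_algebra_hom =
  V: vertex_algebra s1 Y1 vac1 + W: vertex_algebra s2 Y2 vac2 + Vector_Spaces.linear s1 s2 f
  for s1 :: "complex \<Rightarrow> 'v::ab_group_add \<Rightarrow> 'v" and Y1 vac1
    and s2 :: "complex \<Rightarrow> 'w::ab_group_add \<Rightarrow> 'w" and Y2 vac2
    and f :: "'v \<Rightarrow> 'w" +
  assumes hom_vac: "f vac1 = vac2"
    and hom_Y: "f (Y1 a n b) = Y2 (f a) n (f b)"

text \<open>
  The vertex algebra \<open>L\<^sup>H(c\<^sub>L, c\<^sub>L\<^sub>I)\<close>. Simplicity, and generation by the two fields, follow from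
  the irreducibility of the module.
\<close>

locale heis_vir_vertex_algebra =
  vertex_algebra scale Y vac + lie_module scale heis_vir_br act
  for scale :: "complex \<Rightarrow> 'v::ab_group_add \<Rightarrow> 'v" and Y vac act +
  fixes c\<^sub>L c\<^sub>L\<^sub>I :: complex
  assumes vac_nonzero: "vac \<noteq> 0"
    and highest_weight: "n \<ge> 0 \<Longrightarrow> act (HL n) vac = 0" "n \<ge> 0 \<Longrightarrow> act (HI n) vac = 0"
    and central: "act HC\<^sub>L v = scale c\<^sub>L v" "act HC\<^sub>I v = 0" "act HC\<^sub>L\<^sub>I v = scale c\<^sub>L\<^sub>I v"
    and irreducible: irreducible_module
    and field_L: "Y (act (HL (-2)) vac) (n + 1) = act (HL n)"
    and field_I: "Y (act (HI (-1)) vac) n = act (HI n)"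

text \<open>
  The universal vertex algebra \<open>L\<^bsup>W(2,2)\<^esup>(c\<^sub>L, c\<^sub>W)\<close>: its underlying module is induced from the
  subalgebra spanned by \<open>L(n), W(n)\<close> with \<open>n \<ge> -1\<close> (the modes that must annihilate \<open>vac\<close>
  for \<open>L(z)\<close> and \<open>W(z)\<close> to create states) and the centre.
\<close>

definition w22_vacuum_subalgebra :: "w22 set"
  where "w22_vacuum_subalgebra = WL ` {-1..} \<union> WW ` {-1..} \<union> {WC, WC\<^sub>W}"

fun w22_character :: "complex \<Rightarrow> complex \<Rightarrow> w22 \<Rightarrow> complex" where
  "w22_character c\<^sub>L c\<^sub>W WC = c\<^sub>L"
| "w22_character c\<^sub>L c\<^sub>W WC\<^sub>W = c\<^sub>W"
| "w22_character c\<^sub>L c\<^sub>W _ = 0"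

locale w22_vertex_algebra =
  vertex_algebra scale Y vac +
  induced_module scale w22_br act w22_vacuum_subalgebra "w22_character c\<^sub>L c\<^sub>W" vac
  for scale :: "complex \<Rightarrow> 'v::ab_group_add \<Rightarrow> 'v" and Y vac act c\<^sub>L c\<^sub>W +
  assumes field_L: "Y (act (WL (-2)) vac) (n + 1) = act (WL n)"
    and field_W: "Y (act (WW (-2)) vac) (n + 1) = act (WW n)"

end

theory Submission
  imports Defs
begin

text \<open>
  Let \<open>w = (I(-1)\<^sup>2 + 2 c\<^sub>L\<^sub>I I(-2)) \<one>\<close>. Since \<open>C\<^sub>I\<close> acts by zero, the \<open>I(n)\<close> commute,
  hence so do the modes of \<open>w\<close>. Moreover \<open>w\<close> is quasi-primary of weight 2: \<open>L(-1)w\<close> is its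
  translate, \<open>L(0)w = 2w\<close>, \<open>L(1)w = 0\<close>, \<open>L(2)w = -12 c\<^sub>L\<^sub>I\<^sup>2 \<one> = (c\<^sub>W/2) \<one>\<close>, and higher \<open>L(n)\<close>
  kill it. The commutator formula then makes the modes of \<open>\<omega>\<close> and \<open>w\<close> a representation of
  \<open>W(2,2)\<close>, and the universal property of the induced module yields a module map \<open>\<Psi>\<close>. The states
  \<open>a\<close> such that \<open>\<Psi>\<close> intertwines all \<open>a\<^sub>n\<close> form a subspace closed under all products, by the
  iterate formula, and contain the generators; so \<open>\<Psi>\<close> is a homomorphism. Its image is
  not spanned by the vacuum because \<open>L(2)w \<noteq> 0\<close>.
\<close>

section \<open>Linear extensions and induced modules\<close>

lemma lin_ext_pm_scale:
  assumes "vector_space s"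
  shows "lin_ext s f (pm_scale c p) = s c (lin_ext s f p)"
proof -
  interpret vector_space s by fact
  have "Poly_Mapping.keys (pm_scale c p) \<subseteq> Poly_Mapping.keys p"
    by (auto simp: in_keys_iff)
  then show ?thesis
    by (simp add: lin_ext_superset[OF assms, where A = "Poly_Mapping.keys p"] scale_sum_right)
qed

lemma linear_lin_ext:
  assumes "vector_space s"
  shows "Vector_Spaces.linear pm_scale s (lin_ext s f)"
  using assms
  by (auto simp: Vector_Spaces.linear_iff pm.vector_space_axioms lin_ext_add lin_ext_pm_scale)

lemma linear_image_lin_ext:
  assumes "Vector_Spaces.linear s1 s2 g"
  shows "g (lin_ext s1 f p) = lin_ext s2 (\<lambda>k. g (f k)) p"
proof -
  interpret Vector_Spaces.linear s1 s2 g by fact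
  show ?thesis by (simp add: lin_ext_def sum scale)
qed

lemma lin_ext_compose:
  assumes "vector_space s"
  shows "lin_ext s f (lin_ext pm_scale g p) = lin_ext s (\<lambda>k. lin_ext s f (g k)) p"
  by (rule linear_image_lin_ext[OF linear_lin_ext[OF assms]])

lemma (in lie_module) linear_foldr_act: "Vector_Spaces.linear scale scale (foldr act u)"
proof (induction u)
  case Nil
  then show ?case by (auto simp: Vector_Spaces.linear_iff vector_space_axioms)
next
  case (Cons x u)
  show ?case
    using Vector_Spaces.linear_compose[OF Cons.IH act_linear[of x]] by (simp add: comp_def)
qed

text \<open>Evaluating words at \<open>e\<close> kills both kinds of generators: the commutator
  relations because \<open>act\<close> respects brackets and \<open>foldr act u\<close> is linear,
  the others because \<open>e\<close> has character \<open>\<chi>\<close>. This makes maps out of an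
  induced module well defined.\<close>

lemma (in lie_module) induced_relations_vanish:
  assumes e: "\<And>x. x \<in> P \<Longrightarrow> act x e = scale (\<chi> x) e"
    and t: "t \<in> induced_relations br P \<chi>"
  shows "lin_ext scale (\<lambda>w. foldr act w e) t = 0"
proof -
  let ?E = "lin_ext scale (\<lambda>w. foldr act w e)"
  interpret E: Vector_Spaces.linear pm_scale scale ?E
    by (rule linear_lin_ext[OF vector_space_axioms])
  have fold0: "foldr act u 0 = 0"
    and fold_diff: "foldr act u (a - b) = foldr act u a - foldr act u b"
    and fold_scale: "foldr act u (scale c a) = scale c (foldr act u a)" for u a b c
  proof -
    interpret F: Vector_Spaces.linear scale scale "foldr act u" by (rule linear_foldr_act)
    show "foldr act u 0 = 0" "foldr act u (a - b) = foldr act u a - foldr act u b"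
      "foldr act u (scale c a) = scale c (foldr act u a)"
      by (simp_all add: F.diff F.scale)
  qed
  have "?E g = 0" if "g \<in> {Poly_Mapping.single (u @ [x, y] @ v) 1 - Poly_Mapping.single (u @ [y, x] @ v) 1
       - lin_ext pm_scale (\<lambda>z. Poly_Mapping.single (u @ [z] @ v) 1) (br x y) | u v x y. True} \<union>
    {Poly_Mapping.single (u @ [x]) 1 - Poly_Mapping.single u (\<chi> x) | u x. x \<in> P}" for g
    using that
  proof (elim UnE CollectE exE conjE)
    fix u v x y
    assume g: "g = Poly_Mapping.single (u @ [x, y] @ v) 1 - Poly_Mapping.single (u @ [y, x] @ v) 1
       - lin_ext pm_scale (\<lambda>z. Poly_Mapping.single (u @ [z] @ v) 1) (br x y)"
    have "foldr act u (lin_ext scale (\<lambda>z. act z (foldr act v e)) (br x y))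
        = lin_ext scale (\<lambda>z. foldr act u (act z (foldr act v e))) (br x y)"
      by (rule linear_image_lin_ext[OF linear_foldr_act])
    then show "?E g = 0"
      by (simp add: g E.diff lin_ext_single[OF vector_space_axioms]
          lin_ext_compose[OF vector_space_axioms] act_bracket fold_diff)
  next
    fix u x
    assume "g = Poly_Mapping.single (u @ [x]) 1 - Poly_Mapping.single u (\<chi> x)" "x \<in> P"
    then show "?E g = 0"
      by (simp add: E.diff lin_ext_single[OF vector_space_axioms] e fold_scale)
  qed
  then show ?thesis
    using t E.eq_0_on_span unfolding induced_relations_def by blast
qed

context induced_module
begin

lemma act_lin_ext_foldr:
  "act x (lin_ext scale (\<lambda>w. foldr act w e) t)
    = lin_ext scale (\<lambda>w. foldr act w e) (lin_ext pm_scale (\<lambda>w. Poly_Mapping.single (x # w) 1) t)"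
  by (simp add: linear_image_lin_ext[OF act_linear] lin_ext_compose[OF vector_space_axioms]
      lin_ext_single[OF vector_space_axioms])

lemma cyclic_induct:
  assumes S: "subspace S" "e \<in> S" and act: "\<And>x v. v \<in> S \<Longrightarrow> act x v \<in> S"
  shows "v \<in> S"
proof -
  have "foldr act w e \<in> S" for w
    by (induction w) (use assms in auto)
  moreover obtain t where "v = lin_ext scale (\<lambda>w. foldr act w e) t"
    using cyclic by blast
  ultimately show ?thesis
    using S(1) by (auto simp: lin_ext_def intro!: subspace_sum subspace_scale)
qed

lemma act_cyclic_vector:
  assumes "x \<in> P"
  shows "act x e = scale (\<chi> x) e"
proof -
  let ?t = "Poly_Mapping.single [x] 1 - Poly_Mapping.single [] (\<chi> x)"
  have "?t \<in> induced_relations br P \<chi>"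
    unfolding induced_relations_def using assms by (intro pm.span_base UnI2 CollectI exI[of _ "[]"] exI[of _ x]) simp
  then have "lin_ext scale (\<lambda>w. foldr act w e) ?t = 0"
    using kernel by blast
  then show ?thesis
    by (simp add: lin_ext_diff[OF vector_space_axioms] lin_ext_single[OF vector_space_axioms])
qed

text \<open>The character is prescribed only on \<open>e\<close>. As \<open>z\<close> commutes with
  the whole action, its eigenspace for \<open>\<chi> z\<close> is a submodule containing
  \<open>e\<close>, hence everything.\<close>

lemma act_central:
  assumes "z \<in> P" and z: "\<And>x. br z x = 0"
  shows "act z v = scale (\<chi> z) v"
proof -
  have scale: "act x (scale c v) = scale c (act x v)" for x c v
    using act_linear[of x] by (simp add: Vector_Spaces.linear_iff)
  have "v \<in> {v. act z v = scale (\<chi> z) v}"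
  proof (rule cyclic_induct)
    show "subspace {v. act z v = scale (\<chi> z) v}"
      using act_linear[of z]
      by (intro subspaceI) (auto simp: Vector_Spaces.linear_iff scale_right_distrib mult.commute
        module_hom.zero[OF act_linear[of z, unfolded linear_iff_module_hom]])
  next
    fix x v assume "v \<in> {v. act z v = scale (\<chi> z) v}"
    then show "act x v \<in> {v. act z v = scale (\<chi> z) v}"
      using act_bracket[of v z x] by (simp add: z scale lin_ext_zero[OF vector_space_axioms])
  qed (simp add: act_cyclic_vector assms)
  then show ?thesis by simp
qed

lemma universal_property:
  assumes M: "lie_module scale' br act'"
    and e': "\<And>x. x \<in> P \<Longrightarrow> act' x e' = scale' (\<chi> x) e'"
  obtains f where "Vector_Spaces.linear scale scale' f" "f e = e'"
    "\<And>x v. f (act x v) = act' x (f v)"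
proof -
  interpret M: lie_module scale' br act' by (rule M)
  let ?E = "lin_ext scale (\<lambda>w. foldr act w e)" and ?E' = "lin_ext scale' (\<lambda>w. foldr act' w e')"
  interpret E: Vector_Spaces.linear pm_scale scale ?E
    by (rule linear_lin_ext[OF vector_space_axioms])
  interpret E': Vector_Spaces.linear pm_scale scale' ?E'
    by (rule linear_lin_ext[OF M.vector_space_axioms])
  \<comment> \<open>Some word expression of \<open>v\<close> at \<open>e\<close> is re-evaluated at
    \<open>e'\<close>. Two choices differ by an element of the kernel, that is, by relations, which
    vanish in the target.\<close>
  define f where "f v = ?E' (SOME t. v = ?E t)" for v
  have f: "f (?E t) = ?E' t" for t
  proof -
    let ?t = "SOME t'. ?E t = ?E t'"
    have "?E t = ?E ?t" by (rule someI) (rule refl)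
    then have "?E (t - ?t) = 0" by (simp add: E.diff)
    then have "t - ?t \<in> induced_relations br P \<chi>" using kernel by blast
    then have "?E' (t - ?t) = 0"
      by (rule M.induced_relations_vanish[where \<chi> = \<chi>, rotated]) (rule e')
    then show ?thesis by (simp add: f_def E'.diff)
  qed
  have "f (u + v) = f u + f v" for u v
  proof -
    obtain t t' where "u = ?E t" "v = ?E t'" using cyclic by meson
    then show ?thesis by (metis f E.add E'.add)
  qed
  moreover have "f (scale c v) = scale' c (f v)" for c v
  proof -
    obtain t where "v = ?E t" using cyclic by meson
    then show ?thesis by (metis f E.scale E'.scale)
  qed
  moreover have "f (act x v) = act' x (f v)" for x v
  proof -
    obtain t where v: "v = ?E t" using cyclic by meson
    have "act' x (?E' t) = ?E' (lin_ext pm_scale (\<lambda>w. Poly_Mapping.single (x # w) 1) t)"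
      by (simp add: linear_image_lin_ext[OF M.act_linear] lin_ext_compose[OF M.vector_space_axioms]
          lin_ext_single[OF M.vector_space_axioms])
    then show ?thesis by (simp add: v act_lin_ext_foldr f)
  qed
  moreover have "f e = e'"
    using f[of "Poly_Mapping.single [] 1"]
    by (simp add: lin_ext_single[OF vector_space_axioms] lin_ext_single[OF M.vector_space_axioms])
  ultimately show thesis
    using that[of f] by (simp add: Vector_Spaces.linear_iff vector_space_axioms M.vector_space_axioms)
qed

end

section \<open>Consequences of the Borcherds identity\<close>

lemma finite_int_lower:
  fixes P :: "nat \<Rightarrow> bool"
  assumes "\<And>j. int j \<ge> N \<Longrightarrow> \<not> P j"
  shows "finite {j. P j}"
proof (rule finite_subset)
  show "{j. P j} \<subseteq> {..<nat N}" using assms by (force simp: not_le[symmetric])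
qed simp

context vertex_algebra
begin

lemma Y_add_left: "Y (a + b) n c = Y a n c + Y b n c"
  and Y_scale_left: "Y (r *s a) n c = r *s Y a n c"
  and Y_zero_left: "Y 0 n c = 0"
proof -
  interpret l: Vector_Spaces.linear scale scale "\<lambda>a. Y a n c" by (rule Y_linear_left)
  show "Y (a + b) n c = Y a n c + Y b n c" "Y (r *s a) n c = r *s Y a n c" "Y 0 n c = 0"
    by (fact l.add l.scale l.zero)+
qed

lemma Y_add_right: "Y a n (b + c) = Y a n b + Y a n c"
  and Y_scale_right: "Y a n (r *s b) = r *s Y a n b"
  and Y_zero_right: "Y a n 0 = 0"
proof -
  interpret l: Vector_Spaces.linear scale scale "Y a n" by (rule Y_linear_right)
  show "Y a n (b + c) = Y a n b + Y a n c" "Y a n (r *s b) = r *s Y a n b" "Y a n 0 = 0"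
    by (fact l.add l.scale l.zero)+
qed

text \<open>The Borcherds identity at n = 0, where only j = 0 survives on the right.\<close>

lemma commutator:
  "Y a m (Y b k c) - Y b k (Y a m c)
    = Sum_any (\<lambda>j. (of_int m gchoose j) *s Y (Y a (int j) b) (m + k - int j) c)"
proof -
  have "Sum_any (\<lambda>j::nat. ((-1) ^ j * (of_int 0 gchoose j)) *s
         (Y a (m + 0 - int j) (Y b (k + int j) c)
          - ((-1) powi 0) *s Y b (0 + k - int j) (Y a (m + int j) c)))
      = Y a m (Y b k c) - Y b k (Y a m c)"
    by (subst Sum_any.expand_superset[where A = "{0}"])
      (auto simp: gbinomial_0_left split: if_splits)
  then show ?thesis
    using borcherds[of m a 0 b k c] by simp
qed

text \<open>The Borcherds identity at m = 0, where only j = 0 survives on the left.\<close>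

lemma iterate:
  "Y (Y a n b) k c = Sum_any (\<lambda>j::nat. ((-1) ^ j * (of_int n gchoose j)) *s
         (Y a (n - int j) (Y b (k + int j) c)
          - ((-1) powi n) *s Y b (n + k - int j) (Y a (int j) c)))"
proof -
  have "Sum_any (\<lambda>j::nat. (of_int 0 gchoose j) *s Y (Y a (n + int j) b) (0 + k - int j) c)
      = Y (Y a n b) k c"
    by (subst Sum_any.expand_superset[where A = "{0}"])
      (auto simp: gbinomial_0_left split: if_splits)
  then show ?thesis
    using borcherds[of 0 a n b k c] by simp
qed

text \<open>\<open>Sum_any\<close> is 0 by convention on infinite supports, so finiteness is needed
  before a linear map can pass through the sum.\<close>

lemma finite_iterate_support:
  "finite {j::nat. ((-1) ^ j * (of_int n gchoose j)) *s
         (Y a (n - int j) (Y b (k + int j) c)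
          - ((-1) powi n) *s Y b (n + k - int j) (Y a (int j) c)) \<noteq> 0}"
proof -
  obtain N1 where N1: "\<And>n. n \<ge> N1 \<Longrightarrow> Y a n c = 0" using truncation by blast
  obtain N2 where N2: "\<And>n. n \<ge> N2 \<Longrightarrow> Y b n c = 0" using truncation by blast
  show ?thesis
    by (rule finite_int_lower[where N = "max N1 (N2 - k)"]) (simp add: N1 N2 Y_zero_right)
qed

abbreviation translation :: "'v \<Rightarrow> 'v"
  where "translation a \<equiv> Y a (-2) vac"

text \<open>The iterate formula with b the vacuum: the vacuum field has a single nonzero mode, so at
  most one j contributes.\<close>

lemma Y_translation: "Y (translation a) k c = of_int (- k) *s Y a (k - 1) c"
proof -
  have binom: "(-1) ^ j * ((of_int (-2) :: complex) gchoose j) = of_nat (j + 1)" for j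
    using gbinomial_minus[of "2::complex" j] gbinomial_of_nat_symmetric[of j "j+1", where 'a = complex]
    by (simp add: binomial_gbinomial[symmetric] algebra_simps)
  let ?g = "\<lambda>j::nat. ((-1) ^ j * (of_int (-2) gchoose j)) *s
         (Y a (-2 - int j) (Y vac (k + int j) c)
          - ((-1) powi (-2)) *s Y vac (-2 + k - int j) (Y a (int j) c))"
  have g: "?g j = of_nat (j + 1) *s ((if k + int j = -1 then Y a (k - 1) c else 0)
      - (if k - 1 = int j then Y a (k - 1) c else 0))" for j
  proof (cases "k + int j = -1")
    case True
    then have k: "k = -1 - int j" by simp
    show ?thesis unfolding binom k by (simp add: vacuum Y_zero_right)
  next
    case False
    then show ?thesis unfolding binom by (auto simp: vacuum Y_zero_right)
  qed
  \<comment> \<open>The surviving index is -k - 1 for k < 0 and k - 1 for k > 0. For k = 0 nothing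
    survives, and \<open>nat\<close> truncates to the harmless index 0.\<close>
  have "?g j = 0" if "j \<noteq> nat (\<bar>k\<bar> - 1)" for j
    unfolding g using that by auto
  then have "Sum_any ?g = sum ?g {nat (\<bar>k\<bar> - 1)}"
    by (intro Sum_any.expand_superset) blast+
  also have "\<dots> = of_int (- k) *s Y a (k - 1) c"
    unfolding g by (cases "k = 0"; cases "k > 0") (auto simp: g)
  finally show ?thesis by (simp add: iterate)
qed

text \<open>The iterate formula applied to the vacuum: creation removes all \<open>a\<close>-modes
  with index j \<ge> 0 and leaves only j = 0, 1 from \<open>b\<close>.\<close>

lemma translation_Y: "translation (Y a n b) = Y a n (translation b) - of_int n *s Y a (n - 1) b"
proof -
  let ?g = "\<lambda>j::nat. ((-1) ^ j * (of_int n gchoose j)) *s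
         (Y a (n - int j) (Y b (-2 + int j) vac)
          - ((-1) powi n) *s Y b (n + -2 - int j) (Y a (int j) vac))"
  have "?g j = 0" if "j \<notin> {0, 1}" for j
  proof -
    have "Y b (-2 + int j) vac = 0" using that by (intro creation(1)) auto
    then show ?thesis by (simp only: creation(1) Y_zero_right scale_zero_right diff_zero of_nat_0_le_iff)
  qed
  then have "Sum_any ?g = sum ?g {0, 1}"
    by (intro Sum_any.expand_superset) blast+
  also have "\<dots> = Y a n (translation b) - of_int n *s Y a (n - 1) b"
    by (simp add: creation Y_zero_right)
  finally show ?thesis by (simp add: iterate)
qed

end

section \<open>The \<open>W(2,2)\<close>-action on the Heisenberg-Virasoro vertex algebra\<close>

context heis_vir_vertex_algebra
begin

notation scale (infixr \<open>*s\<close> 75)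

lemma act_add: "act x (u + v) = act x u + act x v"
  and act_scale: "act x (r *s v) = r *s act x v"
  and act_zero: "act x 0 = 0"
  and act_minus: "act x (- v) = - act x v"
  and act_diff: "act x (u - v) = act x u - act x v"
proof -
  interpret l: Vector_Spaces.linear scale scale "act x" by (rule act_linear)
  show "act x (u + v) = act x u + act x v" "act x (r *s v) = r *s act x v" "act x 0 = 0"
    "act x (- v) = - act x v" "act x (u - v) = act x u - act x v"
    by (fact l.add l.scale l.zero l.neg l.diff)+
qed

lemmas act_simps = act_add act_scale act_zero act_minus act_diff
lemmas lin_ext_eval = lin_ext_single[OF vector_space_axioms] lin_ext_add[OF vector_space_axioms]
  lin_ext_diff[OF vector_space_axioms] lin_ext_uminus[OF vector_space_axioms]
  lin_ext_zero[OF vector_space_axioms]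

section \<open>Heisenberg-Virasoro modes on the vacuum and on \<open>w\<close>\<close>

lemma HI_HI: "act (HI n) (act (HI m) v) = act (HI m) (act (HI n) v)"
  using act_bracket[of v "HI n" "HI m"] by (simp add: lin_ext_eval central)

lemma HL_HI: "act (HL n) (act (HI m) v) = act (HI m) (act (HL n) v)
    - of_int m *s act (HI (n + m)) v - (if n = - m then of_int (n\<^sup>2 + n) * c\<^sub>L\<^sub>I else 0) *s v"
  using act_bracket[of v "HL n" "HI m"]
  by (simp add: lin_ext_eval central algebra_simps split: if_splits)

text \<open>Not among the highest weight conditions; it holds because \<open>L(-1)\<close> is the
  0-th mode of a field, which creation sends to 0 on the vacuum.\<close>

lemma HL_m1_vac: "act (HL (-1)) vac = 0"
proof -
  have "act (HL (-1)) = Y (act (HL (-2)) vac) 0" using field_L[of "-1"] by simp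
  then show ?thesis by (simp add: creation)
qed

lemma HI_HI_vac: "k \<ge> 0 \<Longrightarrow> act (HI k) (act (HI j) vac) = 0"
  by (simp add: HI_HI[of k j] highest_weight act_zero)

definition w :: 'v
  where "w = act (HI (-1)) (act (HI (-1)) vac) + (2 * c\<^sub>L\<^sub>I) *s act (HI (-2)) vac"

lemma HI_w: "k \<ge> 0 \<Longrightarrow> act (HI k) w = 0"
  by (simp add: w_def act_simps HI_HI_vac highest_weight HI_HI[of k "-1"] HI_HI[of k "-2"])

text \<open>Both \<open>L(-1)\<close> and the translation operator kill the vacuum and have the same commutators
  with the \<open>I(n)\<close>.\<close>

lemma HL_m1_w: "act (HL (-1)) w = translation w"
proof -
  have HI: "translation (act (HI n) v) = act (HI n) (translation v) - of_int n *s act (HI (n - 1)) v" for n v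
    using translation_Y[of "act (HI (-1)) vac" n v] by (simp add: field_I)
  have vac: "translation vac = 0" by (simp add: vacuum)
  show ?thesis
    by (simp add: w_def act_simps HL_HI HL_m1_vac Y_add_left Y_scale_left HI vac)
qed

text \<open>Move \<open>L(n)\<close> to the right until it meets the vacuum. Under
  \<open>L(1)\<close> the square gives \<open>-4 c\<^sub>L\<^sub>I I(-1)\<close> on the vacuum,
  cancelled by the linear term: this fixes its coefficient. Under \<open>L(2)\<close> only the
  anomaly -6 \<open>c\<^sub>L\<^sub>I\<close> of \<open>I(-2)\<close> is left.\<close>

lemma HL_0_w: "act (HL 0) w = 2 *s w"
  and HL_1_w: "act (HL 1) w = 0"
  and HL_2_w: "act (HL 2) w = (- 12 * c\<^sub>L\<^sub>I\<^sup>2) *s vac"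
  and HL_ge3_w: "n \<ge> 3 \<Longrightarrow> act (HL n) w = 0"
proof -
  have double: "u + u = 2 *s u" for u
    using scale_left_distrib[of 1 1 u] by simp
  have cancel: "- (r *s u) - r *s u + (2 * r) *s u = 0" for r u
    using double[of "r *s u"] by (simp add: algebra_simps)
  show "act (HL 0) w = 2 *s w"
    by (simp add: w_def act_simps HL_HI highest_weight scale_right_distrib double)
  show "act (HL 1) w = 0"
    using cancel[of "2 * c\<^sub>L\<^sub>I"] by (simp add: w_def act_simps HL_HI highest_weight HI_HI_vac)
  show "act (HL 2) w = (- 12 * c\<^sub>L\<^sub>I\<^sup>2) *s vac" "n \<ge> 3 \<Longrightarrow> act (HL n) w = 0"
    by (simp_all add: w_def act_simps HL_HI highest_weight HI_HI_vac power2_eq_square mult.assoc)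
qed

section \<open>Commutation relations of the modes of \<open>w\<close>\<close>

lemma HI_Y_w: "act (HI n) (Y w k v) = Y w k (act (HI n) v)"
proof -
  \<comment> \<open>The commutator involves only the states \<open>I(j) w\<close> with j \<ge> 0,
    all zero by \<open>HI_w\<close>.\<close>
  have "Y (act (HI (-1)) vac) n (Y w k v) - Y w k (Y (act (HI (-1)) vac) n v) = 0"
    unfolding commutator by (simp add: field_I HI_w Y_zero_left)
  then show ?thesis by (simp add: field_I)
qed

text \<open>The second \<open>w\<close> is built from the vacuum by \<open>I\<close>-modes;
  \<open>Y w k\<close> commutes past them and kills the vacuum.\<close>

lemma Y_w_w:
  assumes "k \<ge> 0"
  shows "Y w k w = 0"
proof -
  have "Y w k (act (HI (-1)) (act (HI (-1)) vac) + (2 * c\<^sub>L\<^sub>I) *s act (HI (-2)) vac) = 0"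
    using assms by (simp add: Y_add_right Y_scale_right HI_Y_w[symmetric] creation act_zero)
  then show ?thesis by (simp only: w_def[symmetric])
qed

lemma Y_w_commute: "Y w n (Y w k v) = Y w k (Y w n v)"
proof -
  have "Y w n (Y w k v) - Y w k (Y w n v) = 0"
    unfolding commutator by (simp add: Y_w_w Y_zero_left)
  then show ?thesis by simp
qed

text \<open>In the commutator formula the j-th product of the conformal state with \<open>w\<close>
  is \<open>L(j-1) w\<close>, nonzero at most for j = 0, 1, 3. The first two terms add up to 2(n +
  1) - (n + m + 2) = n - m; the third is the central term.\<close>

lemma HL_Y_w: "act (HL n) (Y w (m + 1) v) - Y w (m + 1) (act (HL n) v)
    = of_int (n - m) *s Y w (n + m + 1) v
      + (if n = - m then of_int (n ^ 3 - n) / 12 * (- 24 * c\<^sub>L\<^sub>I\<^sup>2) else 0) *s v"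
proof -
  let ?g = "\<lambda>j. (of_int (n + 1) gchoose j) *s
      Y (Y (act (HL (-2)) vac) (int j) w) (n + 1 + (m + 1) - int j) v"
  have HL: "Y (act (HL (-2)) vac) k = act (HL (k - 1))" for k
    using field_L[of "k - 1"] by simp
  have "?g j = 0" if "j \<notin> {0, 1, 3}" for j
  proof (cases "j = 2")
    case True
    then show ?thesis by (simp add: HL HL_1_w Y_zero_left)
  next
    case False
    then show ?thesis using that HL_ge3_w[of "int j - 1"] by (simp add: HL Y_zero_left)
  qed
  then have "Sum_any ?g = sum ?g {0, 1, 3}"
    by (intro Sum_any.expand_superset) auto
  also have "\<dots> = ?g 0 + (?g 1 + ?g 3)" by simp
  also have "?g 0 = of_int (- (n + m + 2)) *s Y w (n + m + 1) v"
    by (simp add: HL HL_m1_w Y_translation algebra_simps)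
  also have "?g 1 = of_int (2 * (n + 1)) *s Y w (n + m + 1) v"
    by (simp add: HL HL_0_w Y_scale_left algebra_simps)
  also have "?g 3 = (if n = - m then of_int (n ^ 3 - n) / 12 * (- 24 * c\<^sub>L\<^sub>I\<^sup>2) else 0) *s v"
  proof -
    \<comment> \<open>With -12 \<open>c\<^sub>L\<^sub>I\<^sup>2\<close> from \<open>L(2) w\<close>,
      the factor 1/6 becomes 1/12 times -24 \<open>c\<^sub>L\<^sub>I\<^sup>2\<close>.\<close>
    have binom: "((of_int (n + 1) :: complex) gchoose 3) = of_int (n ^ 3 - n) / 6"
      by (simp add: gbinomial_prod_rev fact_numeral numeral_3_eq_3 algebra_simps power3_eq_cube)
    have idx: "n + 1 + (m + 1) - int 3 = n + m - 1" "int 3 - 1 = 2" by simp_all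
    show ?thesis
      unfolding binom HL idx HL_2_w Y_scale_left vacuum by (auto simp: eq_neg_iff_add_eq_0)
  qed
  also have "of_int (- (n + m + 2)) *s Y w (n + m + 1) v + (of_int (2 * (n + 1)) *s Y w (n + m + 1) v + u)
      = of_int (n - m) *s Y w (n + m + 1) v + u" for u
    by (simp add: scale_left_distrib[symmetric] add.assoc[symmetric])
  finally show ?thesis
    using commutator[of "act (HL (-2)) vac" "n + 1" w "m + 1" v] by (simp add: HL)
qed

section \<open>The module structure over \<open>W(2,2)\<close>\<close>

definition w22_act :: "w22 \<Rightarrow> 'v \<Rightarrow> 'v"
  where "w22_act x = (case x of WL n \<Rightarrow> act (HL n) | WW n \<Rightarrow> Y w (n + 1)
    | WC \<Rightarrow> scale c\<^sub>L | WC\<^sub>W \<Rightarrow> scale (- 24 * c\<^sub>L\<^sub>I\<^sup>2))"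

lemma w22_act_simps [simp]:
  "w22_act (WL n) = act (HL n)" "w22_act (WW n) = Y w (n + 1)"
  "w22_act WC = scale c\<^sub>L" "w22_act WC\<^sub>W = scale (- 24 * c\<^sub>L\<^sub>I\<^sup>2)"
  by (simp_all add: w22_act_def)

lemma w22_act_bracket:
  "lin_ext scale (\<lambda>z. w22_act z v) (w22_br x y) = w22_act x (w22_act y v) - w22_act y (w22_act x v)"
proof -
  let ?E = "lin_ext scale (\<lambda>z. w22_act z v)"
  have LW: "?E (w22_br (WL n) (WW m)) = act (HL n) (Y w (m + 1) v) - Y w (m + 1) (act (HL n) v)" for n m
    using HL_Y_w[of n m v] by (simp add: lin_ext_eval)
  show ?thesis
  proof (cases x; cases y)
    fix n m
    assume "x = WL n" "y = WL m"
    then show ?thesis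
      using act_bracket[of v "HL n" "HL m"] by (simp add: lin_ext_eval central)
  next
    fix n m
    assume "x = WL n" "y = WW m"
    then show ?thesis by (simp add: LW del: w22_br.simps)
  next
    fix n m
    assume "x = WW m" "y = WL n"
    then show ?thesis
      by (simp add: w22.br_skew[of "WW m"] lin_ext_eval(4) LW del: w22_br.simps)
  qed (simp_all add: lin_ext_eval Y_w_commute act_simps Y_scale_right mult.commute
      del: scale_minus_left)
qed

lemma lie_module_w22_act: "lie_module scale w22_br w22_act"
proof (intro lie_module.intro lie_module_axioms.intro)
  show "Vector_Spaces.linear scale scale (w22_act x)" for x
    by (cases x) (simp_all add: act_linear Y_linear_right linear_scale_self)
qed (use vector_space_axioms w22.lie_algebra_basis_axioms w22_act_bracket in auto)

text \<open>The hypothesis of the universal property; for the \<open>W(n)\<close> it is creation,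
  since n \<ge> -1 means mode index n + 1 \<ge> 0.\<close>

lemma w22_act_vac:
  assumes "x \<in> w22_vacuum_subalgebra"
  shows "w22_act x vac = scale (w22_character c\<^sub>L (- 24 * c\<^sub>L\<^sub>I\<^sup>2) x) vac"
proof -
  have "act (HL n) vac = 0" if "n \<ge> -1" for n
    using that HL_m1_vac highest_weight(1)[of n] by (cases "n = -1") auto
  then show ?thesis
    using assms by (auto simp: w22_vacuum_subalgebra_def creation)
qed

text \<open>\<open>L(2)\<close> kills multiples of the vacuum but not \<open>w\<close>; here
  \<open>c\<^sub>L\<^sub>I\<close> being nonzero enters.\<close>

lemma w_notin_span_vac:
  assumes "c\<^sub>L\<^sub>I \<noteq> 0"
  shows "w \<notin> span {vac}"
proof
  assume "w \<in> span {vac}"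
  then obtain r where "w = r *s vac" by (auto simp: span_singleton)
  then have "act (HL 2) w = 0" by (simp add: act_simps highest_weight)
  then show False using HL_2_w assms vac_nonzero by simp
qed

end

section \<open>Homomorphisms of vertex algebras\<close>

text \<open>The iterate formula writes modes of \<open>Y1 a n b\<close> through modes of
  \<open>a\<close> and \<open>b\<close>, which \<open>f\<close> already intertwines.\<close>

lemma hom_Y_iterate:
  fixes s1 :: "complex \<Rightarrow> 'v::ab_group_add \<Rightarrow> 'v" and s2 :: "complex \<Rightarrow> 'w::ab_group_add \<Rightarrow> 'w"
  assumes "vertex_algebra s1 Y1 vac1" "vertex_algebra s2 Y2 vac2" "Vector_Spaces.linear s1 s2 f"
    and a: "\<And>n c. f (Y1 a n c) = Y2 (f a) n (f c)"
    and b: "\<And>n c. f (Y1 b n c) = Y2 (f b) n (f c)"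
  shows "f (Y1 (Y1 a n b) k c) = Y2 (f (Y1 a n b)) k (f c)"
proof -
  interpret V: vertex_algebra s1 Y1 vac1 by fact
  interpret W: vertex_algebra s2 Y2 vac2 by fact
  interpret f: Vector_Spaces.linear s1 s2 f by fact
  let ?g = "\<lambda>j::nat. s1 ((-1) ^ j * (of_int n gchoose j))
         (Y1 a (n - int j) (Y1 b (k + int j) c)
          - s1 ((-1) powi n) (Y1 b (n + k - int j) (Y1 a (int j) c)))"
  let ?h = "\<lambda>j::nat. s2 ((-1) ^ j * (of_int n gchoose j))
         (Y2 (f a) (n - int j) (Y2 (f b) (k + int j) (f c))
          - s2 ((-1) powi n) (Y2 (f b) (n + k - int j) (Y2 (f a) (int j) (f c))))"
  have h: "f (?g j) = ?h j" for j by (simp add: f.scale f.diff a b)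
  let ?A = "{j. ?g j \<noteq> 0}"
  have fin: "finite ?A" by (rule V.finite_iterate_support)
  have "f (Sum_any ?g) = (\<Sum>j\<in>?A. ?h j)"
    by (subst Sum_any.expand_set) (simp add: f.sum h)
  \<comment> \<open>The support of \<open>?h\<close> may be smaller than \<open>?A\<close>, as
    \<open>f\<close> need not be injective.\<close>
  also have "\<dots> = Sum_any ?h"
    by (rule Sum_any.expand_superset[symmetric, OF fin]) (metis (mono_tags, lifting) f.zero h mem_Collect_eq subsetI)
  finally show ?thesis by (simp add: V.iterate W.iterate a)
qed

theorem theorem7p1:
  fixes c\<^sub>L c\<^sub>L\<^sub>I c\<^sub>W :: complex
    and scaleW :: "complex \<Rightarrow> 'v::ab_group_add \<Rightarrow> 'v"
    and scaleH :: "complex \<Rightarrow> 'w::ab_group_add \<Rightarrow> 'w"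
  assumes "c\<^sub>L\<^sub>I \<noteq> 0"
    and "c\<^sub>W = - 24 * c\<^sub>L\<^sub>I\<^sup>2"
    and "w22_vertex_algebra scaleW YW vacW actW c\<^sub>L c\<^sub>W"
    and "heis_vir_vertex_algebra scaleH YH vacH actH c\<^sub>L c\<^sub>L\<^sub>I"
  shows "\<exists>\<Psi>. vertex_algebra_hom scaleW YW vacW scaleH YH vacH \<Psi>
    \<and> \<Psi> (actW (WL (-2)) vacW) = actH (HL (-2)) vacH
    \<and> \<Psi> (actW (WW (-2)) vacW)
        = actH (HI (-1)) (actH (HI (-1)) vacH) + scaleH (2 * c\<^sub>L\<^sub>I) (actH (HI (-2)) vacH)
    \<and> (\<exists>v. \<Psi> v \<noteq> 0) \<and> \<not> range \<Psi> \<subseteq> module.span scaleH {vacH}"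
proof -
  interpret V: w22_vertex_algebra scaleW YW vacW actW c\<^sub>L c\<^sub>W by fact
  interpret H: heis_vir_vertex_algebra scaleH YH vacH actH c\<^sub>L c\<^sub>L\<^sub>I by fact
  have "H.w22_act x vacH = scaleH (w22_character c\<^sub>L c\<^sub>W x) vacH" if "x \<in> w22_vacuum_subalgebra" for x
    using H.w22_act_vac[OF that] assms(2) by simp
  then obtain \<Psi> where lin: "Vector_Spaces.linear scaleW scaleH \<Psi>" and vac: "\<Psi> vacW = vacH"
    and act: "\<And>x v. \<Psi> (actW x v) = H.w22_act x (\<Psi> v)"
    using V.universal_property[OF H.lie_module_w22_act] by blast
  interpret \<Psi>: Vector_Spaces.linear scaleW scaleH \<Psi> by (rule lin)
  \<comment> \<open>\<open>W(-2)\<close> acts on the target as the mode of \<open>w\<close> with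
    index -1, which creates \<open>w\<close> from the vacuum.\<close>
  have \<omega>: "\<Psi> (actW (WL (-2)) vacW) = actH (HL (-2)) vacH"
    and w: "\<Psi> (actW (WW (-2)) vacW) = H.w"
    by (simp_all add: act vac H.creation)
  define S where "S = {a. \<forall>n b. \<Psi> (YW a n b) = YH (\<Psi> a) n (\<Psi> b)}"
  have gen: "actW (WL (-2)) vacW \<in> S" "actW (WW (-2)) vacW \<in> S"
  proof -
    have "\<Psi> (YW (actW (WL (-2)) vacW) n b) = YH (\<Psi> (actW (WL (-2)) vacW)) n (\<Psi> b)"
      "\<Psi> (YW (actW (WW (-2)) vacW) n b) = YH (\<Psi> (actW (WW (-2)) vacW)) n (\<Psi> b)" for n b
      using V.field_L[of "n - 1"] V.field_W[of "n - 1"] H.field_L[of "n - 1"]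
      unfolding \<omega> w by (simp_all add: act)
    then show "actW (WL (-2)) vacW \<in> S" "actW (WW (-2)) vacW \<in> S" by (simp_all add: S_def)
  qed
  have sub: "V.subspace S"
    by (rule V.subspaceI)
      (auto simp: S_def V.Y_add_left V.Y_scale_left V.Y_zero_left H.Y_add_left H.Y_scale_left
        H.Y_zero_left \<Psi>.add \<Psi>.scale)
  have closed: "YW a n b \<in> S" if "a \<in> S" "b \<in> S" for a n b
    using hom_Y_iterate[OF V.vertex_algebra_axioms H.vertex_algebra_axioms lin, of a b n] that
    by (simp add: S_def)
  have "a \<in> S" for a
  proof (rule V.cyclic_induct[OF sub])
    show "vacW \<in> S" by (simp add: S_def V.vacuum H.vacuum vac)
    fix x v assume v: "v \<in> S"
    \<comment> \<open>The \<open>L(n)\<close> and \<open>W(n)\<close> preserve \<open>S\<close> as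
      modes of the generators; the central elements must be handled separately, as scalars.\<close>
    have "actW z v = scaleW (w22_character c\<^sub>L c\<^sub>W z) v" if "z \<in> {WC, WC\<^sub>W}" for z
      by (rule V.act_central) (use that in \<open>auto simp: w22_vacuum_subalgebra_def\<close>)
    then show "actW x v \<in> S"
      using V.subspace_scale[OF sub v] closed[OF gen(1) v, of "n + 1" for n, unfolded V.field_L]
        closed[OF gen(2) v, of "n + 1" for n, unfolded V.field_W]
      by (cases x) simp_all
  qed
  then have "vertex_algebra_hom scaleW YW vacW scaleH YH vacH \<Psi>"
    by (intro vertex_algebra_hom.intro vertex_algebra_hom_axioms.intro
        V.vertex_algebra_axioms H.vertex_algebra_axioms lin) (simp_all add: vac S_def)
  moreover have "\<not> range \<Psi> \<subseteq> H.span {vacH}"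
    using H.w_notin_span_vac[OF assms(1)] w by (metis rangeI subsetD)
  ultimately show ?thesis
    using \<omega> w vac H.vac_nonzero unfolding H.w_def by metis
qed

end
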